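(* Suppose that for any attack vertex $a$ the target vertex $\rho$ is distinct from $a$ (i.e. $\rho\in\mathcal V_{-a}$), and that $\mathcal G$ has at least one dominating set of cardinality at most $n_s$. Consider the networked control system $\dot x(t)=-\bar Lx(t)+e_a\zeta(t)$ associated with the undirected connected graph $\mathcal G$, with stealthy data injection attack $\zeta$ at the input of an arbitrary attack vertex $a\in\mathcal V$ and outputs $y_{m_k}=e_{m_k}^\top x$ at the monitor vertices $m_k\in\mathcal M$, where $\mathcal M\subseteq\mathcal V$ is non-empty with $|\mathcal M|\le n_s$. Then the defense cost $R(a,\mathcal M)$ and the expected worst-case impact of stealthy attacks $Q(a,\mathcal M)$ are bounded (finite) for every attack vertex $a\in\mathcal V$ if, and only if, $\mathcal M$ is a dominating set of $\mathcal G$.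
   Context: Graph: $\mathcal G=(\mathcal V,\mathcal E,A)$ is an undirected connected graph with vertex set $\mathcal V=\{1,\dots,N\}$, $N\ge2$, and symmetric adjacency matrix $A=[a_{ij}]$, where $a_{ij}>0$ if $(i,j)\in\mathcal E$, $i\neq j$, and $a_{ij}=0$ otherwise. $L=\Delta-A$ is the Laplacian, with $\Delta$ the diagonal degree matrix, $\Delta_i=\sum_j a_{ij}$. Self-loop gains $\theta_i>0$ are given, $\Theta=\mathrm{diag}(\theta_1,\dots,\theta_N)$, and $\bar L=L+\Theta$. $e_i\in\mathbb R^N$ is the $i$-th standard basis vector, and $\mathcal V_{-a}=\mathcal V\setminus\{a\}$. A set $\mathcal D\subseteq\mathcal V$ is a dominating set if for every $u\in\mathcal V\setminus\mathcal D$ there is $v\in\mathcal D$ with $(u,v)\in\mathcal E$. $n_s$ is the sensor budget (maximum number of sensors). Norms: for a fixed time horizon $[0,T]$, $T>0$, $\|y\|_{\mathcal L_2}^2$ is shorthand for $\|y\|^2_{\mathcal L_2[0,T]}=\frac1T\int_0^T\|y(t)\|_2^2\,dt$. $\mathcal L_{2e}$ is the space of functions $f:\mathbb R_+\to\mathbb R$ with $\|f\|^2_{\mathcal L_2[0,T']}<\infty$ for all $0<T'<\infty$. Impact: given alarm thresholds $\delta_m>0$, $m\in\mathcal V$, and outputs $y_\rho=e_\rho^\top x$, $y_{m_k}=e_{m_k}^\top x$ of $\dot x=-\bar Lx+e_a\zeta$, $$J_\rho(a,\mathcal M)=\sup\Big\{\|y_\rho\|^2_{\mathcal L_2}\ :\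 x(0)=0,\ \zeta\in\mathcal L_{2e},\ \|y_{m_k}\|^2_{\mathcal L_2}\le\delta_{m_k}\ \forall m_k\in\mathcal M\Big\}.$$ For each $a$, $\pi_a$ is a probability mass function on $\mathcal V_{-a}$ with $\pi_a(\rho)>0$ for all $\rho\in\mathcal V_{-a}$. Then $$Q(a,\mathcal M)=\sum_{\rho\in\mathcal V_{-a}}\pi_a(\rho)J_\rho(a,\mathcal M),\qquad R(a,\mathcal M)=\mathfrak c(|\mathcal M|)+Q(a,\mathcal M),$$ where $\mathfrak c(|\mathcal M|)$ is a sensor cost that is bounded for any $\mathcal M\subseteq\mathcal V$. Invariant zeros: $\bar\lambda\in\mathbb C$ is a finite invariant zero of a strictly proper single-input system $(\bar A,\bar B,\bar C,0)$ (i.e. $\dot x=\bar Ax+\bar Bu$, $y=\bar Cx$) if there are $\bar x\ne0$ in $\mathbb C^N$ and $\bar g\in\mathbb C$ with $(\bar\lambda I-\bar A)\bar x-\bar B\bar g=0$ and $\bar C\bar x=0$; it is unstable if its real part is positive. Standing design assumption: the gains $\theta_i$ are selected so that for every pair of input vertex $a$ and output vertex $m$, the system $(-\bar L,e_a,e_m^\top,0)$ has no finite unstable invariant zero. *)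

theory Defs
  imports "HOL-Probability.Probability"
begin

(* Graphs live on a finite vertex type 'n, so N = CARD('n).  A loop (i, i) in E, if any, is
   ignored by the adjacency matrix. *)

definition weighted_graph :: "('n \<times> 'n) set \<Rightarrow> real^'n^'n \<Rightarrow> bool" where
  "weighted_graph E A \<longleftrightarrow> sym E \<and> transpose A = A \<and>
     (\<forall>i j. if (i, j) \<in> E \<and> i \<noteq> j then A $ i $ j > 0 else A $ i $ j = 0)"

definition graph_connected :: "('n \<times> 'n) set \<Rightarrow> bool" where
  "graph_connected E \<longleftrightarrow> (\<forall>u v. (u, v) \<in> E\<^sup>*)"

definition dominating_set :: "('n \<times> 'n) set \<Rightarrow> 'n set \<Rightarrow> bool" where
  "dominating_set E D \<longleftrightarrow> (\<forall>u \<in> UNIV - D. \<exists>v\<in>D. (u, v) \<in> E)"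

definition diag_matrix :: "real^'n \<Rightarrow> real^'n^'n" where
  "diag_matrix d = (\<chi> i j. if i = j then d $ i else 0)"

definition degrees :: "real^'n^'n \<Rightarrow> real^'n" where
  "degrees A = (\<chi> i. \<Sum>j\<in>UNIV. A $ i $ j)"

definition laplacian :: "real^'n^'n \<Rightarrow> real^'n^'n" where
  "laplacian A = diag_matrix (degrees A) - A"

definition looped_laplacian :: "real^'n^'n \<Rightarrow> real^'n \<Rightarrow> real^'n^'n" where
  "looped_laplacian A \<theta> = laplacian A + diag_matrix \<theta>"

(* The squared norm is extended-valued, so that a divergent integral gives \<infinity>. *)

definition L2_norm_sq :: "real \<Rightarrow> (real \<Rightarrow> 'a::real_normed_vector) \<Rightarrow> ennreal" where
  "L2_norm_sq T y = ennreal (1 / T) * (\<integral>\<^sup>+ t\<in>{0..T}. ennreal ((norm (y t))\<^sup>2) \<partial>lebesgue)"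

definition L2e :: "(real \<Rightarrow> real) set" where
  "L2e = {f. f \<in> borel_measurable (lebesgue_on {0..}) \<and> (\<forall>T>0. L2_norm_sq T f < \<infinity>)}"

(* Solutions of x' = A x + b u on [0, \<infinity>) in the sense of Caratheodory: inputs in L2e are only
   measurable, so the equation is required in integrated form.  The right-hand side determines a
   continuous x, hence for u in L2e the integral is also a Lebesgue integral. *)

definition lti_solution ::
    "real^'n^'n \<Rightarrow> real^'n \<Rightarrow> (real \<Rightarrow> real) \<Rightarrow> (real \<Rightarrow> real^'n) \<Rightarrow> bool" where
  "lti_solution A b u x \<longleftrightarrow>
     (\<forall>t\<ge>0. ((\<lambda>s. A *v x s + u s *\<^sub>R b) has_integral (x t - x 0)) {0..t})"

definition vertex_output :: "'n \<Rightarrow> (real \<Rightarrow> real^'n) \<Rightarrow> real \<Rightarrow> real" where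
  "vertex_output m x t = axis m 1 \<bullet> x t"

(* Worst-case impact on target \<rho> of a stealthy attack at a, for horizon T, thresholds \<delta>,
   system matrix - Lb and monitor set M. *)

definition impact ::
    "real \<Rightarrow> ('n \<Rightarrow> real) \<Rightarrow> real^'n^'n \<Rightarrow> 'n \<Rightarrow> 'n \<Rightarrow> 'n set \<Rightarrow> ennreal" where
  "impact T \<delta> Lb \<rho> a M =
     Sup {L2_norm_sq T (vertex_output \<rho> x) | x \<zeta>.
            lti_solution (- Lb) (axis a 1) \<zeta> x \<and> x 0 = 0 \<and> \<zeta> \<in> L2e \<and>
            (\<forall>m\<in>M. L2_norm_sq T (vertex_output m x) \<le> ennreal (\<delta> m))}"

definition expected_impact ::
    "real \<Rightarrow> ('n \<Rightarrow> real) \<Rightarrow> ('n \<Rightarrow> 'n pmf) \<Rightarrow> real^'n^'n \<Rightarrow> 'n \<Rightarrow> 'n set \<Rightarrow> ennreal" where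
  "expected_impact T \<delta> \<pi> Lb a M =
     (\<Sum>\<rho>\<in>UNIV - {a}. ennreal (pmf (\<pi> a) \<rho>) * impact T \<delta> Lb \<rho> a M)"

definition defense_cost ::
    "real \<Rightarrow> ('n \<Rightarrow> real) \<Rightarrow> ('n \<Rightarrow> 'n pmf) \<Rightarrow> (nat \<Rightarrow> ereal) \<Rightarrow> real^'n^'n \<Rightarrow> 'n \<Rightarrow> 'n set \<Rightarrow> ereal" where
  "defense_cost T \<delta> \<pi> c Lb a M = c (card M) + enn2ereal (expected_impact T \<delta> \<pi> Lb a M)"

(* Finite invariant zeros of (A, b, c\<^sup>T, 0).  The output map is spelled out as a sum because the
   inner product on complex^'n is the real one. *)

definition invariant_zero :: "real^'n^'n \<Rightarrow> real^'n \<Rightarrow> real^'n \<Rightarrow> complex \<Rightarrow> bool" where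
  "invariant_zero A b c z \<longleftrightarrow>
     (\<exists>(x :: complex^'n) (g :: complex). x \<noteq> 0 \<and>
        z *s x - map_matrix complex_of_real A *v x
          - g *s (\<chi> i. complex_of_real (b $ i)) = 0 \<and>
        (\<Sum>i\<in>UNIV. complex_of_real (c $ i) * x $ i) = 0)"

definition unstable :: "complex \<Rightarrow> bool" where
  "unstable z \<longleftrightarrow> Re z > 0"

end

theory Submission
  imports Defs
begin

text \<open>If M dominates, then each a lies in M or has a neighbour m in M. In both cases every other
  state is a multiple of x$m plus the response of a linear system driven by x$m, so on a finite
  horizon it is bounded in the L2 norm by x$m.

  If a and its neighbours avoid M, attack with multiples of t^k. As k grows, states at distance 1 from a
  respond like t^(k+2) while states at distance at least 2 are smaller by a factor O(1/k). Hence
  the impact on a neighbour of a is unbounded under any detection thresholds.\<close>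

text \<open>The attack is only measurable and of arbitrary size, so no estimate can pass through it;
  in the bounded case it has to be eliminated. It enters the equation of a alone, but the other
  states still feel it through \<open>x$a\<close>. If a neighbour m is monitored, its equation
  contains \<open>x$a\<close> with a nonzero coefficient, and this lets \<open>x$a\<close> be
  cancelled from the equations of the other states. Recovering \<open>x$a\<close> itself from
  \<open>x$m\<close> would take a derivative, so no such bound is claimed for the target a. Because
  the horizon is finite, exponential growth only enlarges constants.

  In the unbounded case the monitors are still reached along longer paths, so their outputs cannot
  be made to vanish; only their ratio to the output of a neighbour can be made arbitrarily small.
  Every further edge on a path costs one more integration, and integrating t^k divides by k + 1, so
  a large exponent separates the distances. By linearity the amplitude is then free to
  choose.\<close>

section \<open>The L2 norm on a finite horizon\<close>

text \<open>Outputs of solutions are continuous, so this trades the extended-valued Lebesgue norm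
  for a real gauge integral.\<close>

lemma L2_norm_sq_continuous:
  fixes y :: "real \<Rightarrow> real"
  assumes "continuous_on {0..T} y" "T > 0"
  shows "L2_norm_sq T y = ennreal (integral {0..T} (\<lambda>t. (y t)\<^sup>2) / T)"
proof -
  have "(\<lambda>t. (y t)\<^sup>2) integrable_on {0..T}"
    by (intro integrable_continuous_real continuous_intros assms)
  then have hi: "((\<lambda>t. (y t)\<^sup>2) has_integral integral {0..T} (\<lambda>t. (y t)\<^sup>2)) {0..T}"
    by (rule integrable_integral)
  then have "((\<lambda>t. (y t)\<^sup>2 * indicator {0..T} t) has_integral integral {0..T} (\<lambda>t. (y t)\<^sup>2)) UNIV"
    unfolding has_integral_restrict_UNIV[of "{0..T}", symmetric]
    by (rule has_integral_eq[rotated]) auto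
  then have "(\<integral>\<^sup>+ t. ennreal ((y t)\<^sup>2 * indicator {0..T} t) \<partial>lebesgue)
      = ennreal (integral {0..T} (\<lambda>t. (y t)\<^sup>2))"
    by (subst (asm) has_integral_iff_nn_integral_lebesgue) auto
  moreover have "(\<integral>\<^sup>+ t\<in>{0..T}. ennreal ((norm (y t))\<^sup>2) \<partial>lebesgue)
      = (\<integral>\<^sup>+ t. ennreal ((y t)\<^sup>2 * indicator {0..T} t) \<partial>lebesgue)"
    by (intro nn_integral_cong) (auto simp: indicator_def)
  moreover have "0 \<le> integral {0..T} (\<lambda>t. (y t)\<^sup>2)"
    using hi by (rule has_integral_nonneg) auto
  ultimately show ?thesis
    using \<open>T > 0\<close> by (simp add: L2_norm_sq_def ennreal_mult[symmetric])
qed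

lemma L2_norm_sq_mono:
  assumes "\<And>t. t \<in> {0..T} \<Longrightarrow> norm (y t) \<le> norm (z t)"
  shows "L2_norm_sq T y \<le> L2_norm_sq T z"
  unfolding L2_norm_sq_def
  by (intro mult_left_mono nn_integral_mono) (auto simp: indicator_def assms intro!: ennreal_leI power_mono)

lemma L2_norm_sq_monomial:
  assumes "T > 0"
  shows "L2_norm_sq T (\<lambda>t. h * t ^ n) = ennreal (h\<^sup>2 * T ^ (2 * n) / (2 * n + 1))"
proof -
  have "((\<lambda>t. (h * t ^ n)\<^sup>2) has_integral
      h\<^sup>2 * T ^ Suc (2 * n) / real (Suc (2 * n)) - h\<^sup>2 * 0 ^ Suc (2 * n) / real (Suc (2 * n))) {0..T}"
  proof (rule fundamental_theorem_of_calculus)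
    fix t
    have "((\<lambda>t. h\<^sup>2 * t ^ Suc (2 * n) / real (Suc (2 * n))) has_real_derivative (h * t ^ n)\<^sup>2)
        (at t within {0..T})"
      by (rule derivative_eq_intros refl | simp)+
        (simp add: power_mult_distrib power_mult[symmetric] field_simps)
    then show "((\<lambda>t. h\<^sup>2 * t ^ Suc (2 * n) / real (Suc (2 * n))) has_vector_derivative (h * t ^ n)\<^sup>2)
        (at t within {0..T})"
      by (simp add: has_real_derivative_iff_has_vector_derivative)
  qed (use assms in simp)
  then have "integral {0..T} (\<lambda>t. (h * t ^ n)\<^sup>2) = h\<^sup>2 * T ^ Suc (2 * n) / real (Suc (2 * n))"
    by (simp add: integral_unique)
  moreover have "continuous_on {0..T} (\<lambda>t. h * t ^ n)"
    by (intro continuous_intros)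
  ultimately show ?thesis
    using assms by (simp add: L2_norm_sq_continuous)
qed

lemma monomial_in_L2e: "(\<lambda>t. h * t ^ n) \<in> L2e"
proof -
  have "(\<lambda>t::real. h * t ^ n) \<in> borel_measurable (lebesgue_on {0..})"
    by (intro continuous_imp_measurable_on_sets_lebesgue continuous_intros) auto
  then show ?thesis
    by (simp add: L2e_def L2_norm_sq_monomial)
qed

section \<open>Energy estimate and regularity for linear systems\<close>

text \<open>A Gronwall argument for the energy \<open>u \<bullet> u\<close>. In the rate
  \<open>2 * K + 1\<close>, the term \<open>2 * K\<close> absorbs the contribution of
  \<open>B\<close>, and 1 absorbs what Young's inequality leaves of the forcing,
  \<open>2 (u \<bullet> y d) \<le> |u|^2 + |d|^2 y^2\<close>. The exponentially weighted energy
  minus the accumulated forcing then never increases, and it starts at 0.\<close>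

lemma linear_ode_energy_bound:
  fixes u :: "real \<Rightarrow> 'a::real_inner"
  assumes u': "\<And>t. t \<in> {0..T} \<Longrightarrow>
      (u has_vector_derivative B (u t) + y t *\<^sub>R d) (at t within {0..T})"
    and y: "continuous_on {0..T} y" and "u 0 = 0"
    and B: "\<And>v. norm (B v) \<le> K * norm v" and "K \<ge> 0"
    and t: "t \<in> {0..T}"
  shows "(norm (u t))\<^sup>2 \<le> exp ((2 * K + 1) * t) * (norm d)\<^sup>2 * integral {0..t} (\<lambda>s. (y s)\<^sup>2)"
proof -
  define k where "k = 2 * K + 1"
  define h where "h s = exp (- k * s) * (u s \<bullet> u s) - (norm d)\<^sup>2 * integral {0..s} (\<lambda>r. (y r)\<^sup>2)" for s
  define h' where "h' s = exp (- k * s) * (- k * (u s \<bullet> u s) + 2 * (u s \<bullet> (B (u s) + y s *\<^sub>R d)))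
      - (norm d)\<^sup>2 * (y s)\<^sup>2" for s
  have h_deriv: "(h has_real_derivative h' s) (at s within {0..T})" if "s \<in> {0..T}" for s
  proof -
    have I: "((\<lambda>s. integral {0..s} (\<lambda>r. (y r)\<^sup>2)) has_real_derivative (y s)\<^sup>2) (at s within {0..T})"
      by (intro integral_has_real_derivative continuous_intros y that)
    have W: "((\<lambda>s. u s \<bullet> u s) has_real_derivative 2 * (u s \<bullet> (B (u s) + y s *\<^sub>R d))) (at s within {0..T})"
    proof -
      have "((\<lambda>s. u s \<bullet> u s) has_derivative
          (\<lambda>h. u s \<bullet> (h *\<^sub>R (B (u s) + y s *\<^sub>R d)) + (h *\<^sub>R (B (u s) + y s *\<^sub>R d)) \<bullet> u s)) (at s within {0..T})"
        using u'[OF that] unfolding has_vector_derivative_def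
        by (intro has_derivative_inner)
      then show ?thesis
        unfolding has_field_derivative_def
        by (rule has_derivative_eq_rhs) (auto simp: inner_commute fun_eq_iff)
    qed
    show ?thesis
      unfolding h_def[abs_def] h'_def
      by (rule derivative_eq_intros I W refl)+ (simp add: algebra_simps)
  qed
  have h'_nonpos: "h' s \<le> 0" if "s \<in> {0..T}" for s
  proof -
    have "u s \<bullet> B (u s) \<le> norm (u s) * (K * norm (u s))"
      by (meson B norm_cauchy_schwarz norm_ge_zero mult_left_mono order_trans)
    moreover have "2 * (u s \<bullet> (y s *\<^sub>R d)) \<le> (norm (u s))\<^sup>2 + (norm (y s *\<^sub>R d))\<^sup>2"
      using sum_squares_bound[of "norm (u s)" "norm (y s *\<^sub>R d)"] norm_cauchy_schwarz[of "u s" "y s *\<^sub>R d"]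
      by linarith
    moreover have "(norm (y s *\<^sub>R d))\<^sup>2 = (norm d)\<^sup>2 * (y s)\<^sup>2"
      by (simp add: power_mult_distrib)
    ultimately have le: "- k * (u s \<bullet> u s) + 2 * (u s \<bullet> (B (u s) + y s *\<^sub>R d)) \<le> (norm d)\<^sup>2 * (y s)\<^sup>2"
      by (simp add: k_def inner_add_right power2_norm_eq_inner[symmetric] power2_eq_square algebra_simps)
    have "k * s \<ge> 0"
      using that \<open>K \<ge> 0\<close> by (simp add: k_def)
    then have "exp (- k * s) * ((norm d)\<^sup>2 * (y s)\<^sup>2) \<le> 1 * ((norm d)\<^sup>2 * (y s)\<^sup>2)"
      by (intro mult_right_mono) auto
    moreover have "exp (- k * s) * (- k * (u s \<bullet> u s) + 2 * (u s \<bullet> (B (u s) + y s *\<^sub>R d)))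
        \<le> exp (- k * s) * ((norm d)\<^sup>2 * (y s)\<^sup>2)"
      by (intro mult_left_mono le) simp
    ultimately show ?thesis
      unfolding h'_def by linarith
  qed
  \<comment> \<open>At the ends of the horizon the derivative is only one-sided; the criterion used
    here asks for two-sided derivatives in the open interval and for continuity up to its
    ends.\<close>
  have "h t \<le> h 0"
  proof (rule DERIV_nonpos_imp_decreasing_open[where f = h and a = 0 and b = t])
    show "0 \<le> t" using t by simp
  next
    fix s assume s: "0 < s" "s < t"
    show "\<exists>r. (h has_real_derivative r) (at s) \<and> r \<le> 0"
    proof -
      have "s \<in> interior {0..T}" using s t by simp
      then have "(h has_real_derivative h' s) (at s)"
        using h_deriv[of s] at_within_interior[of s "{0..T}"] interior_subset[of "{0..T}"] by auto
      then show ?thesis using h'_nonpos[of s] s t by auto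
    qed
  next
    have "continuous_on {0..T} h"
      using h_deriv by (meson DERIV_continuous continuous_on_eq_continuous_within)
    then show "continuous_on {0..t} h"
      by (rule continuous_on_subset) (use t in auto)
  qed
  then have "exp (- k * t) * (norm (u t))\<^sup>2 \<le> (norm d)\<^sup>2 * integral {0..t} (\<lambda>s. (y s)\<^sup>2)"
    by (simp add: h_def \<open>u 0 = 0\<close> power2_norm_eq_inner)
  then have "exp (k * t) * (exp (- k * t) * (norm (u t))\<^sup>2)
      \<le> exp (k * t) * ((norm d)\<^sup>2 * integral {0..t} (\<lambda>s. (y s)\<^sup>2))"
    by (intro mult_left_mono) auto
  moreover have "exp (k * t) * (exp (- k * t) * (norm (u t))\<^sup>2) = (norm (u t))\<^sup>2"
    by (simp add: mult.assoc[symmetric] exp_add[symmetric])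
  ultimately show ?thesis
    unfolding k_def by (metis mult.assoc)
qed

text \<open>The integrated equation makes \<open>x\<close> a constant plus an indefinite integral,
  which is continuous however irregular the input is.\<close>

lemma lti_solution_continuous_on:
  assumes "lti_solution A b u x"
  shows "continuous_on {0..T} x"
proof (cases "0 \<le> T")
  case True
  define f where "f s = A *v x s + u s *\<^sub>R b" for s
  have f: "(f has_integral (x t - x 0)) {0..t}" if "0 \<le> t" for t
    using assms that by (simp add: lti_solution_def f_def[abs_def])
  have "f integrable_on {0..T}"
    using f[OF True] by blast
  then have "continuous_on {0..T} (\<lambda>t. x 0 + integral {0..t} f)"
    by (intro continuous_intros indefinite_integral_continuous_1)
  then show ?thesis
  proof (rule continuous_on_eq)
    show "x 0 + integral {0..t} f = x t" if "t \<in> {0..T}" for t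
      using integral_unique[OF f, of t] that by simp
  qed
qed auto

text \<open>A map that kills \<open>b\<close> removes the input from the integrated equation. The
  remaining integrand is continuous, so the fundamental theorem of calculus turns the equation into
  a differential one, as the energy estimate requires.\<close>

lemma lti_solution_linear_image:
  fixes f :: "real^'n \<Rightarrow> 'b::banach"
  assumes x: "lti_solution A b u x" and f: "bounded_linear f" "f b = 0" and t: "t \<in> {0..T}"
  shows "((\<lambda>t. f (x t)) has_vector_derivative f (A *v x t)) (at t within {0..T})"
proof -
  have cont: "continuous_on {0..T} (\<lambda>s. f (A *v x s))"
    by (intro bounded_linear.continuous_on[OF f(1)] continuous_intros 
        bounded_linear.continuous_on[OF matrix_vector_mul_bounded_linear] lti_solution_continuous_on[OF x])
  have "f (x s) = f (x 0) + integral {0..s} (\<lambda>s. f (A *v x s))" if "s \<in> {0..T}" for s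
  proof -
    have "(f \<circ> (\<lambda>s. A *v x s + u s *\<^sub>R b) has_integral f (x s - x 0)) {0..s}"
      using x that f(1) by (intro has_integral_linear) (auto simp: lti_solution_def)
    moreover have "f \<circ> (\<lambda>s. A *v x s + u s *\<^sub>R b) = (\<lambda>s. f (A *v x s))"
      by (simp add: fun_eq_iff linear_simps[OF f(1)] f(2))
    ultimately show ?thesis
      by (simp add: integral_unique linear_simps[OF f(1)])
  qed
  moreover have "((\<lambda>s. f (x 0) + integral {0..s} (\<lambda>s. f (A *v x s))) has_vector_derivative f (A *v x t))
      (at t within {0..T})"
    using has_vector_derivative_add[OF has_vector_derivative_const integral_has_vector_derivative[OF cont t]]
    by simp
  ultimately show ?thesis
    by (rule has_vector_derivative_transform[OF t])
qed

section \<open>Bounded impact from a monitor at or next to the attack\<close>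

text \<open>Subtracting the right multiple c$i of the monitored state from every other state cancels the
  unmonitored state x$a and hence the input; what remains is a linear system forced by x$m alone.\<close>

lemma output_L2_bound:
  fixes A :: "real^'n^'n"
  assumes "m = a \<or> A $ m $ a \<noteq> 0" "\<rho> \<noteq> a" "T > 0"
  obtains C where "C \<ge> 0"
    "\<And>u x. lti_solution A (axis a 1) u x \<Longrightarrow> x 0 = 0 \<Longrightarrow>
      integral {0..T} (\<lambda>t. (x t $ \<rho>)\<^sup>2) \<le> C * integral {0..T} (\<lambda>t. (x t $ m)\<^sup>2)"
proof -
  define c :: "real^'n" where "c = (if m = a then 0 else (\<chi> i. A $ i $ a / A $ m $ a))"
  define f :: "real^'n \<Rightarrow> real^'n" where "f v = (\<chi> i. if i = a then 0 else v $ i - c $ i * v $ m)" for v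
  define B :: "real^'n^'n" where "B = (\<chi> i j. if i = a \<or> j = a then 0 else A $ i $ j - c $ i * A $ m $ j)"
  \<comment> \<open>The direction in which \<open>x$m\<close> forces the reduced system: for
    \<open>m = a\<close> it is the column of \<open>A\<close> through which \<open>x$a\<close>
    drives the other states, otherwise the image under \<open>B\<close> of the part that
    \<open>f\<close> subtracted.\<close>
  define d :: "real^'n" where "d = (if m = a then (\<chi> i. if i = a then 0 else A $ i $ a) else B *v c)"
  have "linear f"
    by (rule linearI) (auto simp: f_def vec_eq_iff algebra_simps)
  then have f: "bounded_linear f"
    by (rule linear_conv_bounded_linear[THEN iffD1])
  have fb: "f (axis a 1) = 0"
    by (auto simp: f_def vec_eq_iff axis_def c_def)
  have fA: "f (A *v v) = B *v f v + v $ m *\<^sub>R d" for v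
  proof (cases "m = a")
    case True
    have "(A *v v) $ i = (B *v f v) $ i + v $ a * A $ i $ a" if "i \<noteq> a" for i
    proof -
      have "(A *v v) $ i = A $ i $ a * v $ a + (\<Sum>j\<in>UNIV - {a}. A $ i $ j * v $ j)"
        by (simp add: matrix_vector_mult_def sum.remove[of UNIV a])
      moreover have "(B *v f v) $ i = (\<Sum>j\<in>UNIV - {a}. A $ i $ j * v $ j)"
        using that True by (simp add: matrix_vector_mult_def sum.remove[of UNIV a] B_def f_def c_def)
      ultimately show ?thesis by simp
    qed
    moreover have "(B *v f v) $ a = 0"
      by (simp add: matrix_vector_mult_def B_def)
    ultimately show ?thesis
      using True by (auto simp: vec_eq_iff d_def f_def[of "A *v v"] c_def)
  next
    case False
    have "f (A *v v) $ i = (B *v v) $ i" for i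
    proof (cases "i = a")
      case True
      then show ?thesis by (simp add: f_def B_def matrix_vector_mult_def)
    next
      case i: False
      have "A $ i $ a - c $ i * A $ m $ a = 0"
        using False assms(1) by (simp add: c_def)
      then have "B $ i $ j = A $ i $ j - c $ i * A $ m $ j" for j
        using i by (simp add: B_def)
      then show ?thesis
        using i by (simp add: f_def matrix_vector_mult_def sum_distrib_left sum_subtractf[symmetric]
            left_diff_distrib mult.assoc)
    qed
    \<comment> \<open>Away from \<open>a\<close>, \<open>v\<close> equals \<open>f v\<close> plus
      \<open>v $ m\<close> times \<open>c\<close>, and column \<open>a\<close> of \<open>B\<close>
      is zero.\<close>
    moreover have "B *v v = B *v f v + v $ m *\<^sub>R (B *v c)"
      by (auto simp: vec_eq_iff matrix_vector_mult_def B_def f_def sum_distrib_left sum.distrib[symmetric]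
          algebra_simps intro!: sum.cong)
    ultimately show ?thesis
      using False by (simp add: vec_eq_iff d_def)
  qed
  obtain K where K: "K > 0" "\<And>v. norm (B *v v) \<le> K * norm v"
    using linear_bounded_pos[OF matrix_vector_mul_linear] by blast
  \<comment> \<open>Both factors 2 come from \<open>(p + q)^2 \<le> 2 p^2 + 2 q^2\<close>, applied
    to the reduced state plus the subtracted multiple of \<open>x$m\<close>. The factor
    \<open>T\<close> comes from integrating the energy bound, made constant in time by replacing
    \<open>t\<close> with \<open>T\<close>.\<close>
  define C where "C = 2 * (T * exp ((2 * K + 1) * T) * (norm d)\<^sup>2) + 2 * (c $ \<rho>)\<^sup>2"
  show ?thesis
  proof
    show "C \<ge> 0" using \<open>T > 0\<close> by (simp add: C_def)
    fix u x assume x: "lti_solution A (axis a 1) u x" and "x 0 = 0"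
    let ?I = "integral {0..T} (\<lambda>t. (x t $ m)\<^sup>2)"
    have cont: "continuous_on {0..T} (\<lambda>t. x t $ i)" for i
      by (intro continuous_on_component lti_solution_continuous_on[OF x])
    have int: "(\<lambda>t. (x t $ i)\<^sup>2) integrable_on {0..T}" for i
      by (intro integrable_continuous_real continuous_intros cont)
    have pt: "(x t $ \<rho>)\<^sup>2 \<le> 2 * (exp ((2 * K + 1) * T) * (norm d)\<^sup>2 * ?I) + 2 * (c $ \<rho>)\<^sup>2 * (x t $ m)\<^sup>2"
      if t: "t \<in> {0..T}" for t
    proof -
      have "(norm (f (x t)))\<^sup>2 \<le> exp ((2 * K + 1) * t) * (norm d)\<^sup>2 * integral {0..t} (\<lambda>t. (x t $ m)\<^sup>2)"
        using lti_solution_linear_image[OF x f fb] cont K t \<open>x 0 = 0\<close>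
        by (intro linear_ode_energy_bound[where B = "(*v) B"]) (auto simp: fA linear_simps[OF f])
      also have "\<dots> \<le> exp ((2 * K + 1) * T) * (norm d)\<^sup>2 * ?I"
        using t K(1) int
        by (intro mult_mono integral_subset_le) (auto intro!: integral_nonneg integrable_on_subinterval[OF int])
      finally have "(norm (f (x t)))\<^sup>2 \<le> exp ((2 * K + 1) * T) * (norm d)\<^sup>2 * ?I" .
      moreover have "(f (x t) $ \<rho>)\<^sup>2 \<le> (norm (f (x t)))\<^sup>2"
        using component_le_norm_cart[of "f (x t)" \<rho>] by (metis abs_ge_zero power_mono power2_abs)
      moreover have "x t $ \<rho> = f (x t) $ \<rho> + c $ \<rho> * x t $ m"
        using \<open>\<rho> \<noteq> a\<close> by (simp add: f_def)
      moreover have "(p + q)\<^sup>2 \<le> 2 * p\<^sup>2 + 2 * q\<^sup>2" for p q :: real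
        using sum_squares_bound[of p q] by (simp add: power2_sum)
      note this[of "f (x t) $ \<rho>" "c $ \<rho> * x t $ m"]
      ultimately show ?thesis
        by (simp only: power_mult_distrib)
    qed
    define P where "P = exp ((2 * K + 1) * T) * (norm d)\<^sup>2 * ?I"
    have "((\<lambda>t. 2 * P + 2 * (c $ \<rho>)\<^sup>2 * (x t $ m)\<^sup>2) has_integral
        (T - 0) *\<^sub>R (2 * P) + 2 * (c $ \<rho>)\<^sup>2 * ?I) {0..T}"
      using \<open>T > 0\<close> has_integral_const_real[of "2 * P" 0 T]
      by (intro has_integral_add has_integral_mult_right integrable_integral int) simp
    then have "integral {0..T} (\<lambda>t. (x t $ \<rho>)\<^sup>2) \<le> (T - 0) *\<^sub>R (2 * P) + 2 * (c $ \<rho>)\<^sup>2 * ?I"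
      by (rule has_integral_le[OF integrable_integral[OF int]]) (use pt in \<open>simp add: P_def\<close>)
    also have "\<dots> = C * ?I"
      by (simp add: C_def P_def algebra_simps)
    finally show "integral {0..T} (\<lambda>t. (x t $ \<rho>)\<^sup>2) \<le> C * ?I" .
  qed
qed

lemma vertex_output_eq: "vertex_output m x t = x t $ m"
  by (simp add: vertex_output_def inner_axis')

text \<open>One well-placed monitor suffices, as further monitors only remove admissible attacks.
  The constant relating target and monitor is the same for all attacks, so the threshold
  \<open>\<delta> m\<close> caps them all at once.\<close>

lemma impact_finite:
  fixes L :: "real^'n^'n"
  assumes "m \<in> M" "m = a \<or> L $ m $ a \<noteq> 0" "\<rho> \<noteq> a" "T > 0"
  shows "impact T \<delta> L \<rho> a M < \<infinity>"
proof -
  have "m = a \<or> (- L) $ m $ a \<noteq> 0" using assms by simp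
  from this \<open>\<rho> \<noteq> a\<close> \<open>T > 0\<close> obtain C where C: "C \<ge> 0"
    "\<And>u x. lti_solution (- L) (axis a 1) u x \<Longrightarrow> x 0 = 0 \<Longrightarrow>
      integral {0..T} (\<lambda>t. (x t $ \<rho>)\<^sup>2) \<le> C * integral {0..T} (\<lambda>t. (x t $ m)\<^sup>2)"
    by (rule output_L2_bound) blast
  have "impact T \<delta> L \<rho> a M \<le> ennreal C * ennreal (\<delta> m)"
    unfolding impact_def
  proof (rule Sup_least, clarify)
    fix x \<zeta>
    assume x: "lti_solution (- L) (axis a 1) \<zeta> x" "x 0 = 0"
      and "\<forall>m\<in>M. L2_norm_sq T (vertex_output m x) \<le> ennreal (\<delta> m)"
    then have le: "L2_norm_sq T (vertex_output m x) \<le> ennreal (\<delta> m)"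
      using \<open>m \<in> M\<close> by blast
    have norm: "L2_norm_sq T (vertex_output i x) = ennreal (integral {0..T} (\<lambda>t. (x t $ i)\<^sup>2) / T)" for i
      using L2_norm_sq_continuous[OF continuous_on_component[OF lti_solution_continuous_on[OF x(1)]] \<open>T > 0\<close>]
      by (simp add: vertex_output_eq[abs_def])
    have "L2_norm_sq T (vertex_output \<rho> x) \<le> ennreal (C * (integral {0..T} (\<lambda>t. (x t $ m)\<^sup>2) / T))"
      unfolding norm using C(2)[OF x] \<open>T > 0\<close> by (intro ennreal_leI) (simp add: divide_simps)
    also have "\<dots> = ennreal C * L2_norm_sq T (vertex_output m x)"
      unfolding norm using C(1) by (simp only: ennreal_mult')
    also have "\<dots> \<le> ennreal C * ennreal (\<delta> m)"
      by (intro mult_left_mono le) simp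
    finally show "L2_norm_sq T (vertex_output \<rho> x) \<le> ennreal C * ennreal (\<delta> m)" .
  qed
  also have "\<dots> < \<infinity>"
    by (simp add: ennreal_mult_less_top)
  finally show ?thesis .
qed

section \<open>Power-series responses to monomial attacks\<close>

text \<open>The solution is the power series with coefficients
  A^(n-k-1) b (k+2)!/n! for n > k; the states not hit by b see the input only from degree k + 2 on.\<close>

lemma lti_solution_monomial_input:
  fixes A :: "real^'n^'n" and b :: "real^'n"
  assumes "T \<ge> 0"
  obtains C where "C \<ge> 0"
    "\<And>k. \<exists>x. lti_solution A b (\<lambda>t. real ((k + 1) * (k + 2)) * t ^ k) x \<and> x 0 = 0 \<and>
      (\<forall>i. b $ i = 0 \<longrightarrow> (\<forall>t\<in>{0..T}.
        \<bar>x t $ i - (A *v b) $ i * t ^ (k + 2)\<bar> \<le> C / real (k + 1) * t ^ (k + 2)))"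
proof -
  obtain K0 where K0: "\<And>v. norm (A *v v) \<le> K0 * norm v"
    using linear_bounded_pos[OF matrix_vector_mul_linear] by blast
  \<comment> \<open>With \<open>K \<ge> 1\<close>, powers of \<open>K\<close> increase, so
    \<open>K ^ (n - k - 1)\<close> can be bounded by \<open>K ^ n\<close> in the comparison with an
    exponential series.\<close>
  define K where "K = max 1 K0"
  have K: "K \<ge> 1" "norm (A *v v) \<le> K * norm v" for v
    using K0[of v] mult_right_mono[of K0 K "norm v"] by (auto simp: K_def)
  define v where "v j = (((*v) A) ^^ j) b" for j
  have v_Suc: "v (Suc j) = A *v v j" for j
    by (simp add: v_def)
  have v_norm: "norm (v j) \<le> K ^ j * norm b" for j
  proof (induction j)
    case 0
    then show ?case by (simp add: v_def)
  next
    case (Suc j)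
    have "norm (v (Suc j)) \<le> K * norm (v j)"
      using K(2) by (simp add: v_Suc)
    also have "\<dots> \<le> K * (K ^ j * norm b)"
      using Suc K(1) by (intro mult_left_mono) auto
    finally show ?case by (simp add: mult.assoc)
  qed
  \<comment> \<open>The remainder starts at degree k + 3 with coefficient vector \<open>v 2\<close>,
    whence \<open>K\<^sup>2\<close>; beyond the common factor t^(k+2) its terms carry t^(n+1),
    bounded by \<open>T * T ^ n\<close>; summing over \<open>n\<close> gives the
    exponential.\<close>
  define C where "C = norm b * K\<^sup>2 * T * exp (K * T)"
  show ?thesis
  proof
    show "C \<ge> 0" using assms by (simp add: C_def)
    fix k :: nat
    \<comment> \<open>The input factor (k+1)(k+2) is undone by two integrations, so the coefficient
      in degree k + 2 is exactly \<open>A *v b\<close>. Degree k + 1 carries a multiple of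
      \<open>b\<close>.\<close>
    define c where "c i n = (if n \<le> k then 0 else v (n - k - 1) $ i * (fact (k + 2) / fact n))" for i n
    define x where "x t = (\<chi> i. \<Sum>n. c i n * t ^ n)" for t
    have summ: "summable (\<lambda>n. c i n * t ^ n)" for i t
    proof (rule summable_comparison_test')
      show "summable (\<lambda>n. norm b * fact (k + 2) * (inverse (fact n) * (K * \<bar>t\<bar>) ^ n))"
        by (intro summable_mult summable_exp)
      fix n :: nat
      have "\<bar>c i n\<bar> \<le> K ^ n * norm b * (fact (k + 2) / fact n)"
      proof (cases "n \<le> k")
        case True
        then show ?thesis using K(1) by (simp add: c_def)
      next
        case False
        have "\<bar>v (n - k - 1) $ i\<bar> \<le> K ^ (n - k - 1) * norm b"
          using component_le_norm_cart v_norm order_trans by blast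
        also have "\<dots> \<le> K ^ n * norm b"
          using K(1) by (intro mult_right_mono power_increasing) auto
        finally have "\<bar>v (n - k - 1) $ i\<bar> * (fact (k + 2) / fact n) \<le> K ^ n * norm b * (fact (k + 2) / fact n)"
          by (rule mult_right_mono) simp
        then show ?thesis
          using False by (simp add: c_def abs_mult del: fact_Suc)
      qed
      then have "\<bar>c i n\<bar> * \<bar>t\<bar> ^ n \<le> K ^ n * norm b * (fact (k + 2) / fact n) * \<bar>t\<bar> ^ n"
        by (rule mult_right_mono) simp
      then show "norm (c i n * t ^ n) \<le> norm b * fact (k + 2) * (inverse (fact n) * (K * \<bar>t\<bar>) ^ n)"
        by (simp add: abs_mult power_abs power_mult_distrib field_simps del: fact_Suc)
    qed
    \<comment> \<open>Comparing coefficients of t^n in the differential equation; the input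
      contributes in degree \<open>k\<close> only.\<close>
    have diffs_c: "diffs (c i) n = (\<Sum>j\<in>UNIV. A $ i $ j * c j n) +
        (if n = k then real ((k + 1) * (k + 2)) * b $ i else 0)" for i n
    proof -
      consider "n < k" | "n = k" | "n > k" by linarith
      then show ?thesis
      proof cases
        case 1
        then show ?thesis by (simp add: diffs_def c_def)
      next
        case 2
        have "real (Suc k) * (fact (k + 2) / fact (Suc k)) = real ((k + 1) * (k + 2))"
        proof -
          have "fact (k + 2) = real (k + 2) * fact (Suc k)"
            using fact_Suc[of "Suc k", where 'a = real] by simp
          then have "fact (k + 2) / fact (Suc k) = real (k + 2)"
            by (simp del: fact_Suc)
          then show ?thesis
            by (simp only: of_nat_mult Suc_eq_plus1)
        qed
        moreover have "diffs (c i) k = real (Suc k) * (fact (k + 2) / fact (Suc k)) * b $ i"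
          by (simp add: diffs_def c_def v_def del: fact_Suc of_nat_Suc)
        moreover have "c j k = 0" for j
          by (simp add: c_def)
        ultimately show ?thesis
          using 2 by simp
      next
        case 3
        then have "Suc n - k - 1 = Suc (n - k - 1)" by simp
        then have "v (Suc n - k - 1) $ i = (\<Sum>j\<in>UNIV. A $ i $ j * v (n - k - 1) $ j)"
          by (simp add: v_Suc matrix_vector_mult_def)
        moreover have "real (Suc n) * (fact (k + 2) / fact (Suc n)) = fact (k + 2) / fact n"
          by (subst fact_Suc[of n]) (simp del: fact_Suc of_nat_Suc)
        moreover have "diffs (c i) n = real (Suc n) * (fact (k + 2) / fact (Suc n)) * v (Suc n - k - 1) $ i"
          using 3 by (simp add: diffs_def c_def del: fact_Suc of_nat_Suc)
        moreover have "c j n = v (n - k - 1) $ j * (fact (k + 2) / fact n)" for j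
          using 3 by (simp add: c_def)
        ultimately show ?thesis
          using 3 by (simp add: sum_distrib_left mult_ac del: fact_Suc of_nat_Suc)
      qed
    qed
    have deriv: "((\<lambda>t. x t $ i) has_real_derivative
        (A *v x t + (real ((k + 1) * (k + 2)) * t ^ k) *\<^sub>R b) $ i) (at t)" for i t
    proof -
      have "(\<lambda>n. A $ i $ j * (c j n * t ^ n)) sums (A $ i $ j * x t $ j)" for j
        unfolding x_def by (simp add: sums_mult summable_sums summ)
      then have "(\<lambda>n. \<Sum>j\<in>UNIV. A $ i $ j * (c j n * t ^ n)) sums (\<Sum>j\<in>UNIV. A $ i $ j * x t $ j)"
        by (rule sums_sum)
      from sums_add[OF this sums_single[of k "\<lambda>k. real ((k + 1) * (k + 2)) * b $ i * t ^ k"]]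
      have "(\<lambda>n. (\<Sum>j\<in>UNIV. A $ i $ j * (c j n * t ^ n))
            + (if n = k then real ((n + 1) * (n + 2)) * b $ i * t ^ n else 0))
          sums ((A *v x t + (real ((k + 1) * (k + 2)) * t ^ k) *\<^sub>R b) $ i)"
        by (simp add: matrix_vector_mult_def mult_ac)
      moreover have "diffs (c i) n * t ^ n = (\<Sum>j\<in>UNIV. A $ i $ j * (c j n * t ^ n))
            + (if n = k then real ((n + 1) * (n + 2)) * b $ i * t ^ n else 0)" for n
        by (simp add: diffs_c distrib_right sum_distrib_right mult.assoc)
      ultimately have "(\<lambda>n. diffs (c i) n * t ^ n) sums ((A *v x t + (real ((k + 1) * (k + 2)) * t ^ k) *\<^sub>R b) $ i)"
        by (simp only:)
      moreover have "((\<lambda>t. x t $ i) has_real_derivative (\<Sum>n. diffs (c i) n * t ^ n)) (at t)"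
        unfolding x_def using termdiffs_strong_converges_everywhere[OF summ] by simp
      ultimately show ?thesis
        by (simp only: sums_unique[symmetric])
    qed
    have sol: "lti_solution A b (\<lambda>t. real ((k + 1) * (k + 2)) * t ^ k) x"
      unfolding lti_solution_def
    proof (intro allI impI)
      fix t :: real assume "t \<ge> 0"
      have "((\<lambda>s. (A *v x s + (real ((k + 1) * (k + 2)) * s ^ k) *\<^sub>R b) $ i) has_integral
          (x t $ i - x 0 $ i)) {0..t}" for i
        using \<open>t \<ge> 0\<close> deriv
        by (intro fundamental_theorem_of_calculus)
          (auto simp: has_real_derivative_iff_has_vector_derivative intro: has_vector_derivative_at_within)
      then show "((\<lambda>s. A *v x s + (real ((k + 1) * (k + 2)) * s ^ k) *\<^sub>R b) has_integral (x t - x 0)) {0..t}"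
        by (subst has_integral_componentwise_iff) (auto simp: Basis_vec_def inner_axis)
    qed
    have x0: "x 0 = 0"
      by (simp add: x_def vec_eq_iff c_def)
    have "\<bar>x t $ i - (A *v b) $ i * t ^ (k + 2)\<bar> \<le> C / real (k + 1) * t ^ (k + 2)"
      if i: "b $ i = 0" and t: "t \<in> {0..T}" for i t
    proof -
      define M where "M = t ^ (k + 2) * (norm b * K\<^sup>2 * T / real (k + 1))"
      have "x t $ i = (\<Sum>n. c i (n + (k + 3)) * t ^ (n + (k + 3))) + (\<Sum>n<k + 3. c i n * t ^ n)"
        unfolding x_def using suminf_split_initial_segment[OF summ] by simp
      \<comment> \<open>Of the initial segment only degree k + 2 survives: lower coefficients are 0
        by definition, except in degree k + 1, where the coefficient is a multiple of
        \<open>b $ i = 0\<close>.\<close>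
      also have "(\<Sum>n<k + 3. c i n * t ^ n) = (\<Sum>n\<in>{k + 2}. c i n * t ^ n)"
      proof (rule sum.mono_neutral_right)
        show "\<forall>n\<in>{..<k + 3} - {k + 2}. c i n * t ^ n = 0"
        proof
          fix n assume "n \<in> {..<k + 3} - {k + 2}"
          then consider "n \<le> k" | "n = k + 1" by force
          then show "c i n * t ^ n = 0"
            by cases (auto simp: c_def v_def i)
        qed
      qed auto
      also have "(\<Sum>n\<in>{k + 2}. c i n * t ^ n) = (A *v b) $ i * t ^ (k + 2)"
        by (simp add: c_def v_def del: fact_Suc)
      finally have "x t $ i - (A *v b) $ i * t ^ (k + 2) = (\<Sum>n. c i (n + (k + 3)) * t ^ (n + (k + 3)))"
        by simp
      also have "norm \<dots> \<le> (\<Sum>n. M * (inverse (fact n) * (K * T) ^ n))"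
      proof (rule norm_suminf_le)
        fix n :: nat
        \<comment> \<open>Source of the decay in k: splitting off \<open>fact n\<close> leaves
          (k+2)!/(k+3)! = 1/(k+3), at most 1/(k+1), while 1/n! keeps the series summable uniformly
          in k.\<close>
        have "fact n * fact (k + 3) \<le> (fact (n + (k + 3)) :: nat)"
          by (intro dvd_imp_le fact_fact_dvd_fact) simp
        then have "fact n * fact (k + 3) \<le> (fact (n + (k + 3)) :: real)"
          by (metis of_nat_fact of_nat_le_iff of_nat_mult)
        moreover have "real (k + 1) * fact (k + 2) \<le> (fact (k + 3) :: real)"
        proof -
          have "fact (k + 3) = real (k + 3) * fact (k + 2)"
            by (simp add: numeral_3_eq_3)
          then show ?thesis by (simp add: mult_right_mono del: fact_Suc)
        qed
        ultimately have "fact n * (real (k + 1) * fact (k + 2)) \<le> (fact (n + (k + 3)) :: real)"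
          by (meson fact_ge_zero mult_left_mono order_trans)
        moreover have "p / q \<le> inverse r / s" if "r * (s * p) \<le> q" "q > 0" "r > 0" "s > 0" for p q r s :: real
          using that by (simp add: field_simps)
        ultimately have fact_le: "fact (k + 2) / fact (n + (k + 3)) \<le> inverse (fact n) / real (k + 1)"
          by (simp del: fact_Suc)
        have "\<bar>c i (n + (k + 3))\<bar> = \<bar>v (n + 2) $ i\<bar> * (fact (k + 2) / fact (n + (k + 3)))"
          by (simp add: c_def abs_mult numeral_3_eq_3 del: fact_Suc)
        also have "\<dots> \<le> (K ^ (n + 2) * norm b) * (inverse (fact n) / real (k + 1))"
          using component_le_norm_cart[of "v (n + 2)" i] v_norm[of "n + 2"] K(1)
          by (intro mult_mono fact_le) (auto intro: order_trans simp del: fact_Suc)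
        finally have "\<bar>c i (n + (k + 3))\<bar> \<le> (K ^ (n + 2) * norm b) * (inverse (fact n) / real (k + 1))" .
        moreover have "t ^ (n + (k + 3)) \<le> t ^ (k + 2) * (T ^ n * T)"
        proof -
          have "t ^ (n + 1) \<le> T ^ (n + 1)" using t by (intro power_mono) auto
          then have "t ^ (k + 2) * t ^ (n + 1) \<le> t ^ (k + 2) * T ^ (n + 1)"
            using t by (intro mult_left_mono) auto
          moreover have "n + (k + 3) = (k + 2) + (n + 1)" by simp
          ultimately show ?thesis by (simp only: power_add[of t "k + 2"]) (simp add: mult_ac)
        qed
        ultimately have "\<bar>c i (n + (k + 3))\<bar> * t ^ (n + (k + 3)) \<le>
            ((K ^ (n + 2) * norm b) * (inverse (fact n) / real (k + 1))) * (t ^ (k + 2) * (T ^ n * T))"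
          using t K(1) by (intro mult_mono) auto
        moreover have "norm (c i (n + (k + 3)) * t ^ (n + (k + 3))) = \<bar>c i (n + (k + 3))\<bar> * t ^ (n + (k + 3))"
          using t by (simp add: abs_mult)
        moreover have "((K ^ (n + 2) * norm b) * (inverse (fact n) / real (k + 1))) * (t ^ (k + 2) * (T ^ n * T))
            = M * (inverse (fact n) * (K * T) ^ n)"
          by (simp only: M_def power_add power_mult_distrib times_divide_eq_left times_divide_eq_right mult_ac)
        ultimately show "norm (c i (n + (k + 3)) * t ^ (n + (k + 3))) \<le> M * (inverse (fact n) * (K * T) ^ n)"
          by simp
      qed (intro summable_mult summable_exp)
      also have "(\<Sum>n. M * (inverse (fact n) * (K * T) ^ n)) = M * exp (K * T)"
        using suminf_mult[OF summable_exp, of M "K * T"] by (simp add: exp_def scaleR_conv_of_real)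
      also have "M * exp (K * T) = C / real (k + 1) * t ^ (k + 2)"
        by (simp add: M_def C_def)
      finally show ?thesis by simp
    qed
    with sol x0 show "\<exists>x. lti_solution A b (\<lambda>t. real ((k + 1) * (k + 2)) * t ^ k) x \<and> x 0 = 0 \<and>
      (\<forall>i. b $ i = 0 \<longrightarrow> (\<forall>t\<in>{0..T}.
        \<bar>x t $ i - (A *v b) $ i * t ^ (k + 2)\<bar> \<le> C / real (k + 1) * t ^ (k + 2)))"
      by blast
  qed
qed

section \<open>Unbounded impact when the attack has distance at least 2 from all monitors\<close>

lemma lti_solution_scale:
  assumes "lti_solution A b u x"
  shows "lti_solution A b (\<lambda>t. s * u t) (\<lambda>t. s *\<^sub>R x t)"
  unfolding lti_solution_def
proof (intro allI impI)
  fix t :: real assume "t \<ge> 0"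
  then have "((\<lambda>r. s *\<^sub>R (A *v x r + u r *\<^sub>R b)) has_integral s *\<^sub>R (x t - x 0)) {0..t}"
    using assms by (intro has_integral_cmul) (auto simp: lti_solution_def)
  then show "((\<lambda>r. A *v (s *\<^sub>R x r) + (s * u r) *\<^sub>R b) has_integral (s *\<^sub>R x t - s *\<^sub>R x 0)) {0..t}"
    by (simp add: algebra_simps matrix_vector_mult_scaleR)
qed

text \<open>The leading coefficient of the response at a vertex \<open>i \<noteq> a\<close> is
  \<open>- L $ i $ a\<close>, which vanishes at the monitors but not at \<open>\<rho>\<close>. For
  any demanded impact \<open>G\<close> the amplitude is fixed by the target; the exponent
  \<open>k\<close> is then taken so large that the monitors stay below their thresholds.\<close>

lemma impact_infinite:
  fixes L :: "real^'n^'n"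
  assumes "a \<notin> M" "\<And>m. m \<in> M \<Longrightarrow> L $ m $ a = 0" "L $ \<rho> $ a \<noteq> 0" "\<rho> \<noteq> a"
    and "T > 0" "\<And>m. \<delta> m > 0"
  shows "impact T \<delta> L \<rho> a M = \<infinity>"
proof -
  have "T \<ge> 0" using \<open>T > 0\<close> by simp
  then obtain C where "C \<ge> 0" and C:
    "\<And>k. \<exists>x. lti_solution (- L) (axis a 1) (\<lambda>t. real ((k + 1) * (k + 2)) * t ^ k) x \<and> x 0 = 0 \<and>
      (\<forall>i. axis a (1::real) $ i = 0 \<longrightarrow> (\<forall>t\<in>{0..T}.
        \<bar>x t $ i - (- L *v axis a 1) $ i * t ^ (k + 2)\<bar> \<le> C / real (k + 1) * t ^ (k + 2)))"
    by (rule lti_solution_monomial_input) blast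
  define \<alpha> where "\<alpha> = \<bar>L $ \<rho> $ a\<bar>"
  \<comment> \<open>One positive threshold that serves all monitors, available because there are
    finitely many vertices.\<close>
  define \<mu> where "\<mu> = Min (range \<delta>)"
  have "\<alpha> > 0" using assms(3) by (simp add: \<alpha>_def)
  have "\<mu> > 0" using assms(6) by (simp add: \<mu>_def)
  have "ennreal G \<le> impact T \<delta> L \<rho> a M" if "G > 0" for G
  proof -
    \<comment> \<open>Solves \<open>(H * (\<alpha> / 2))\<^sup>2 = G\<close>, where
      \<open>\<alpha> / 2\<close> is the part of the leading coefficient guaranteed to remain at the
      target.\<close>
    define H where "H = 2 * sqrt G / \<alpha>"
    have "H > 0" using that \<open>\<alpha> > 0\<close> by (simp add: H_def)
    \<comment> \<open>The first bound keeps half of the leading coefficient at the target, the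
      second gives \<open>H * \<epsilon> \<le> sqrt \<mu>\<close> at the monitors.\<close>
    define \<epsilon> where "\<epsilon> = min (\<alpha> / 2) (sqrt \<mu> / H)"
    have "\<epsilon> > 0" using \<open>\<alpha> > 0\<close> \<open>\<mu> > 0\<close> \<open>H > 0\<close> by (simp add: \<epsilon>_def)
    obtain k :: nat where "C / \<epsilon> < real k"
      using reals_Archimedean2 by blast
    then have "C < \<epsilon> * real (k + 1)"
      using \<open>\<epsilon> > 0\<close> by (simp add: field_simps)
    then have k: "C / real (k + 1) \<le> \<epsilon>"
      by (simp add: divide_simps)
    obtain x where x: "lti_solution (- L) (axis a 1) (\<lambda>t. real ((k + 1) * (k + 2)) * t ^ k) x" "x 0 = 0"
      and x_approx: "\<And>i t. i \<noteq> a \<Longrightarrow> t \<in> {0..T} \<Longrightarrow>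
        \<bar>x t $ i - (- L *v axis a 1) $ i * t ^ (k + 2)\<bar> \<le> C / real (k + 1) * t ^ (k + 2)"
      using C[of k] by (auto simp: axis_def)
    have approx: "\<bar>x t $ i + L $ i $ a * t ^ (k + 2)\<bar> \<le> \<epsilon> * t ^ (k + 2)"
      if "i \<noteq> a" "t \<in> {0..T}" for i t
    proof -
      have "(- L *v axis a 1) $ i = - L $ i $ a"
        by (simp add: matrix_vector_mult_basis column_def)
      then have "\<bar>x t $ i + L $ i $ a * t ^ (k + 2)\<bar> \<le> C / real (k + 1) * t ^ (k + 2)"
        using x_approx[OF that] by simp
      also have "\<dots> \<le> \<epsilon> * t ^ (k + 2)"
        using that by (intro mult_right_mono k) simp
      finally show ?thesis .
    qed
    define p q where "p = T ^ (2 * (k + 2))" and "q = real (2 * (k + 2) + 1)"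
    have "p > 0" "q > 0" using \<open>T > 0\<close> by (simp_all add: p_def q_def)
    \<comment> \<open>Normalises \<open>h * t ^ (k + 2)\<close> to squared norm
      \<open>H\<^sup>2\<close> for every \<open>k\<close>, so \<open>H\<close> and
      \<open>\<epsilon>\<close> could be fixed before \<open>k\<close>.\<close>
    define h where "h = H * sqrt (q / p)"
    have "h > 0" using \<open>H > 0\<close> \<open>p > 0\<close> \<open>q > 0\<close> by (simp add: h_def)
    have h_norm: "L2_norm_sq T (\<lambda>t. (h * r) * t ^ (k + 2)) = ennreal ((H * r)\<^sup>2)" for r
    proof -
      have "(h * r)\<^sup>2 * p / q = (H * r)\<^sup>2"
        using \<open>p > 0\<close> \<open>q > 0\<close> by (simp add: h_def power_mult_distrib)
      then show ?thesis
        unfolding L2_norm_sq_monomial[OF \<open>T > 0\<close>] p_def q_def by simp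
    qed
    let ?X = "\<lambda>t. h *\<^sub>R x t" and ?\<zeta> = "\<lambda>t. h * (real ((k + 1) * (k + 2)) * t ^ k)"
    have "lti_solution (- L) (axis a 1) ?\<zeta> ?X"
      by (rule lti_solution_scale[OF x(1)])
    moreover have "?\<zeta> \<in> L2e"
      using monomial_in_L2e[of "h * real ((k + 1) * (k + 2))" k] by (simp only: mult.assoc)
    moreover have "L2_norm_sq T (vertex_output m ?X) \<le> ennreal (\<delta> m)" if "m \<in> M" for m
    proof -
      have "norm (vertex_output m ?X t) \<le> norm ((h * \<epsilon>) * t ^ (k + 2))" if "t \<in> {0..T}" for t
      proof -
        have "\<bar>x t $ m\<bar> \<le> \<epsilon> * t ^ (k + 2)"
          using approx[of m t] assms(1,2) \<open>m \<in> M\<close> that by auto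
        then show ?thesis
          using \<open>h > 0\<close> \<open>\<epsilon> > 0\<close> that by (simp add: vertex_output_eq abs_mult)
      qed
      then have "L2_norm_sq T (vertex_output m ?X) \<le> ennreal ((H * \<epsilon>)\<^sup>2)"
        unfolding h_norm[symmetric] by (rule L2_norm_sq_mono)
      also have "H * \<epsilon> \<le> sqrt \<mu>"
        using \<open>H > 0\<close> by (simp add: \<epsilon>_def min_def field_simps)
      then have "(H * \<epsilon>)\<^sup>2 \<le> (sqrt \<mu>)\<^sup>2"
        using \<open>H > 0\<close> \<open>\<epsilon> > 0\<close> by (intro power_mono) auto
      then have "(H * \<epsilon>)\<^sup>2 \<le> \<delta> m"
        using \<open>\<mu> > 0\<close> Min_le[of "range \<delta>" "\<delta> m", folded \<mu>_def] by simp
      then have "ennreal ((H * \<epsilon>)\<^sup>2) \<le> ennreal (\<delta> m)"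
        by (rule ennreal_leI)
      finally show ?thesis .
    qed
    ultimately have "L2_norm_sq T (vertex_output \<rho> ?X) \<le> impact T \<delta> L \<rho> a M"
      unfolding impact_def using x(2) by (intro Sup_upper CollectI exI[of _ ?X] exI[of _ ?\<zeta>]) auto
    moreover have "norm ((h * (\<alpha> / 2)) * t ^ (k + 2)) \<le> norm (vertex_output \<rho> ?X t)"
      if t: "t \<in> {0..T}" for t
    proof -
      have "\<epsilon> * t ^ (k + 2) \<le> \<alpha> / 2 * t ^ (k + 2)"
        using t min.cobounded1[of "\<alpha> / 2" "sqrt \<mu> / H", folded \<epsilon>_def] by (intro mult_right_mono) auto
      moreover have "\<bar>L $ \<rho> $ a * t ^ (k + 2)\<bar> = \<alpha> * t ^ (k + 2)"
        using t by (simp add: \<alpha>_def abs_mult)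
      ultimately have "\<alpha> / 2 * t ^ (k + 2) \<le> \<bar>x t $ \<rho>\<bar>"
        using approx[OF \<open>\<rho> \<noteq> a\<close> t] by linarith
      then have "h * (\<alpha> / 2 * t ^ (k + 2)) \<le> h * \<bar>x t $ \<rho>\<bar>"
        using \<open>h > 0\<close> by (intro mult_left_mono) auto
      then show ?thesis
        using \<open>h > 0\<close> \<open>\<alpha> > 0\<close> t by (simp add: vertex_output_eq abs_mult)
    qed
    then have "ennreal ((H * (\<alpha> / 2))\<^sup>2) \<le> L2_norm_sq T (vertex_output \<rho> ?X)"
      unfolding h_norm[symmetric] by (rule L2_norm_sq_mono)
    moreover have "(H * (\<alpha> / 2))\<^sup>2 = G"
      using \<open>\<alpha> > 0\<close> that by (simp add: H_def)
    ultimately show ?thesis by simp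
  qed
  from this[of "real n" for n] have "of_nat n \<le> impact T \<delta> L \<rho> a M" for n
    by (cases "n = 0") (simp_all add: ennreal_of_nat_eq_real_of_nat)
  then show ?thesis
    by (metis ennreal_Ex_less_of_nat infinity_ennreal_def leD top.not_eq_extremum)
qed

section \<open>Finite cost and domination\<close>

lemma looped_laplacian_offdiag:
  assumes "i \<noteq> j"
  shows "looped_laplacian A \<theta> $ i $ j = - A $ i $ j"
  using assms by (simp add: looped_laplacian_def laplacian_def diag_matrix_def)

theorem theorem2:
  fixes E :: "('n::finite \<times> 'n) set"
    and A :: "real^'n^'n"
    and \<theta> :: "real^'n"
    and T :: real
    and \<delta> :: "'n \<Rightarrow> real"
    and \<pi> :: "'n \<Rightarrow> 'n pmf"
    and c :: "nat \<Rightarrow> ereal"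
    and n\<^sub>s :: nat
    and M :: "'n set"
  assumes "CARD('n) \<ge> 2"
    and "weighted_graph E A"
    and "graph_connected E"
    and "\<And>i. \<theta> $ i > 0"
    and "T > 0"
    and "\<And>m. \<delta> m > 0"
    and "\<And>a. set_pmf (\<pi> a) = UNIV - {a}"
    and "\<exists>B::real. \<forall>S::'n set. \<bar>c (card S)\<bar> \<le> ereal B"
    and "\<And>a m z. invariant_zero (- looped_laplacian A \<theta>) (axis a 1) (axis m 1) z \<Longrightarrow> \<not> unstable z"
    and "\<exists>D. dominating_set E D \<and> card D \<le> n\<^sub>s"
    and "M \<noteq> {}"
    and "card M \<le> n\<^sub>s"
  shows "(\<forall>a. \<bar>defense_cost T \<delta> \<pi> c (looped_laplacian A \<theta>) a M\<bar> < \<infinity> \<and>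
              expected_impact T \<delta> \<pi> (looped_laplacian A \<theta>) a M < \<infinity>)
         \<longleftrightarrow> dominating_set E M"
proof
  let ?L = "looped_laplacian A \<theta>"
  \<comment> \<open>Column \<open>u\<close> of \<open>?L\<close> shows which other states
    \<open>x$u\<close> drives directly; these are the neighbours of \<open>u\<close>, up to the
    orientation settled by symmetry of \<open>E\<close>.\<close>
  have edge: "?L $ v $ u \<noteq> 0 \<longleftrightarrow> (u, v) \<in> E" if "u \<noteq> v" for u v
  proof -
    have "A $ v $ u \<noteq> 0 \<longleftrightarrow> (v, u) \<in> E"
      using \<open>weighted_graph E A\<close> that unfolding weighted_graph_def by (metis less_irrefl)
    then show ?thesis
      using \<open>weighted_graph E A\<close> that by (auto simp: looped_laplacian_offdiag weighted_graph_def dest: symD)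
  qed
  show "dominating_set E M"
    if fin: "\<forall>a. \<bar>defense_cost T \<delta> \<pi> c ?L a M\<bar> < \<infinity> \<and> expected_impact T \<delta> \<pi> ?L a M < \<infinity>"
  proof (rule ccontr)
    assume "\<not> dominating_set E M"
    then obtain a where a: "a \<notin> M" "\<And>m. m \<in> M \<Longrightarrow> (a, m) \<notin> E"
      by (auto simp: dominating_set_def)
    have "\<not> CARD('n) \<le> Suc 0"
      using \<open>CARD('n) \<ge> 2\<close> by simp
    then obtain b where "b \<noteq> a"
      by (metis UNIV_I card_le_Suc0_iff_eq finite)
    obtain \<rho> where \<rho>: "(a, \<rho>) \<in> E" "\<rho> \<noteq> a"
    proof -
      \<comment> \<open>\<open>E\<close> may contain loops. On a path from \<open>a\<close> to
        \<open>b\<close> without them, the first step already leads to a genuine neighbour of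
        \<open>a\<close>.\<close>
      have "(a, b) \<in> (E - Id)\<^sup>*"
        using \<open>graph_connected E\<close> by (simp add: graph_connected_def rtrancl_r_diff_Id)
      then show ?thesis
        using \<open>b \<noteq> a\<close> that by (auto elim: converse_rtranclE)
    qed
    have "impact T \<delta> ?L \<rho> a M = \<infinity>"
      using a \<rho> assms(5,6) edge by (intro impact_infinite) metis+
    \<comment> \<open>In \<open>ennreal\<close>, \<open>0 * \<infinity> = 0\<close>, so a zero
      weight would hide the infinite impact.\<close>
    moreover have "pmf (\<pi> a) \<rho> > 0"
      using assms(7) \<rho>(2) by (intro pmf_positive) auto
    ultimately have "ennreal (pmf (\<pi> a) \<rho>) * impact T \<delta> ?L \<rho> a M = \<infinity>"
      by (simp add: ennreal_mult_top)
    then have "expected_impact T \<delta> \<pi> ?L a M = \<infinity>"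
      using \<rho>(2) by (auto simp: expected_impact_def)
    then show False using fin by (metis less_irrefl)
  qed
  show "\<forall>a. \<bar>defense_cost T \<delta> \<pi> c ?L a M\<bar> < \<infinity> \<and> expected_impact T \<delta> \<pi> ?L a M < \<infinity>"
    if dom: "dominating_set E M"
  proof
    fix a
    obtain m where m: "m \<in> M" "m = a \<or> ?L $ m $ a \<noteq> 0"
      using dom edge unfolding dominating_set_def by (metis DiffI UNIV_I)
    have "impact T \<delta> ?L \<rho> a M < \<infinity>" if "\<rho> \<noteq> a" for \<rho>
      by (rule impact_finite[OF m that \<open>T > 0\<close>])
    then have fin: "expected_impact T \<delta> \<pi> ?L a M < \<infinity>"
      by (auto simp: expected_impact_def ennreal_mult_less_top)
    then obtain r where "expected_impact T \<delta> \<pi> ?L a M = ennreal r" "r \<ge> 0"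
      by (cases "expected_impact T \<delta> \<pi> ?L a M") auto
    \<comment> \<open>The sensor cost is an \<open>ereal\<close>; the bound on its absolute value
      excludes both infinities.\<close>
    moreover obtain B where "\<bar>c (card M)\<bar> \<le> ereal B"
      using assms(8) by blast
    then have "\<bar>c (card M)\<bar> < \<infinity>"
      by (rule order_le_less_trans) simp
    ultimately have "\<bar>defense_cost T \<delta> \<pi> c ?L a M\<bar> < \<infinity>"
      by (cases "c (card M)") (auto simp: defense_cost_def enn2ereal_ennreal)
    with fin show "\<bar>defense_cost T \<delta> \<pi> c ?L a M\<bar> < \<infinity> \<and> expected_impact T \<delta> \<pi> ?L a M < \<infinity>"
      by simp
  qed
qed

end
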